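(* Let $\mathbb{V}$ be a real Hilbert space with norm $\|\cdot\|$ and let $\mathbb{J}$ be a finite nonempty set. 1. Let $\{W_j\}_{j\in\mathbb{J}}$ be a family of pairwise disjoint symmetric subsets of $\mathbb{V}$ such that the closed subspaces $\mathbb{V}_j=\overline{\mathrm{span}}\,W_j$, $j\in\mathbb{J}$, satisfy $\sum_{j\in\mathbb{J}}\mathbb{V}_j=\mathbb{V}$. 2. Let $\{|||\cdot|||_j\}_{j\in\mathbb{J}}$ be a family of (local) norms such that, for every $j\in\mathbb{J}$, $|||\cdot|||_j$ is a norm on $\mathbb{V}_j$ which is equivalent to the restriction to $\mathbb{V}_j$ of the Hilbertian norm $\|\cdot\|$. Denote $B_j=\{v\in\mathbb{V}_j:|||v|||_j\le1\}$ and $S_j=\{v\in\mathbb{V}_j:|||v|||_j=1\}$. 3. Let $\{\theta_j\}_{j\in\mathbb{J}}$ be a family of symmetric mappings $\theta_j:W_j\to\mathbb{V}$, that is, $\theta_j(-w)=-\theta_j(w)$ for all $w\in W_j$ and all $j\in\mathbb{J}$, such that $$S_j\subset\overline{\theta_j(W_j)}\subset B_j,\qquad\forall j\in\mathbb{J}.$$ 4. Let $h:\mathbb{V}\to\overline{\mathbb{R}}$ be a function such that $(\theta_j\rhd h)^{\star}$ is proper for every $j\in\mathbb{J}$, and $\bigcap_{j\in\mathbb{J}}\mathrm{dom}\,(\theta_j\rhd h)^{\star}\ne\emptyset$. Then there exists a norm $|||\cdot|||$ on $\mathbb{V}$, with unit ball $\overline{\mathrm{co}}\big(\bigcup_{j\in\mathbb{J}}B_j\big)$,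 such that we have the lower bound $$\min_{|||v|||\le1}\Big(\sup_{j\in\mathbb{J}}(\theta_j\rhd h)^{\star}\Big)^{\star}(v)\;\le\;\inf_{w\in\bigcup_{j\in\mathbb{J}}W_j}h(w).$$ Moreover, the norm $|||\cdot|||$ and its dual norm $|||\cdot|||_\star$ are given by $$|||v|||=\inf\Big\{\sum_{j\in\mathbb{J}}|||v^{j}|||_j: v^{j}\in\mathbb{V}_j\ (j\in\mathbb{J}),\ \sum_{j\in\mathbb{J}}v^{j}=v\Big\},\qquad |||v'|||_\star=\sup_{j\in\mathbb{J}}|||\pi_j(v')|||_{j,\star},\qquad\forall v,v'\in\mathbb{V},$$ where $\pi_j$ is the orthogonal projection of $\mathbb{V}$ onto $\mathbb{V}_j$ and $|||\cdot|||_{j,\star}$ is the dual norm of $|||\cdot|||_j$ on $\mathbb{V}_j$.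
   Context: $\overline{\mathbb{R}}=[-\infty,+\infty]$. Infimal postcomposition: for $\theta_j:W_j\to\mathbb{V}$, $(\theta_j\rhd h)(v)=\inf\{h(w):w\in W_j,\ \theta_j(w)=v\}$ for $v\in\mathbb{V}$, with $\inf\emptyset=+\infty$. Fenchel conjugate of $f:\mathbb{V}\to\overline{\mathbb{R}}$: $f^{\star}(v')=\sup_{v\in\mathbb{V}}\big(\langle v,v'\rangle\underset{\cdot}{+}(-f(v))\big)$, where $\underset{\cdot}{+}$ is the addition on $\overline{\mathbb{R}}$ with $(+\infty)\underset{\cdot}{+}(-\infty)=-\infty$. $\mathrm{dom}\,f=\{v:f(v)<+\infty\}$; $f$ is proper if $\mathrm{dom}\,f\neq\emptyset$ and $f$ never takes the value $-\infty$. A set $W$ is symmetric if $-W=W$. $\overline{\mathrm{span}}$ is the closed linear span, $\overline{\mathrm{co}}$ the closed convex hull, and $\overline{\theta_j(W_j)}$ the closure for the Hilbertian topology. Unit balls are closed unit balls. The dual norm of a norm on a Hilbert space is the support function of its unit ball (when this is a norm): $|||v'|||_\star=\sup_{|||v|||\le1}\langle v,v'\rangle$ and $|||v'|||_{j,\star}=\sup_{v\in B_j}\langle v,v'\rangle$ for $v'\in\mathbb{V}_j$. Two norms are equivalent if each is bounded by a positive constant times the other. "min" means that the infimum is attained. *)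

theory Defs
  imports "HOL-Analysis.Analysis"
begin

text \<open>A real Hilbert space is a type of sort \<open>{real_inner, complete_space}\<close>.
  Norms on a subspace \<open>S\<close> are functions on the whole type of which only the values on \<open>S\<close> matter,
  and a mapping defined on \<open>W\<close> is likewise a total function used only on \<open>W\<close>.\<close>

definition closed_span :: "'a::real_normed_vector set \<Rightarrow> 'a set" where
  "closed_span W = closure (span W)"

definition closed_convex_hull :: "'a::real_normed_vector set \<Rightarrow> 'a set" where
  "closed_convex_hull X = closure (convex hull X)"

definition symmetric_set :: "'a::real_vector set \<Rightarrow> bool" where
  "symmetric_set W \<longleftrightarrow> uminus ` W = W"

definition symmetric_map_on :: "'a::real_vector set \<Rightarrow> ('a \<Rightarrow> 'a) \<Rightarrow> bool" where
  "symmetric_map_on W \<theta> \<longleftrightarrow> (\<forall>w\<in>W. \<theta> (- w) = - \<theta> w)"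

definition norm_on :: "'a::real_vector set \<Rightarrow> ('a \<Rightarrow> real) \<Rightarrow> bool" where
  "norm_on S p \<longleftrightarrow>
     (\<forall>x\<in>S. 0 \<le> p x \<and> (p x = 0 \<longleftrightarrow> x = 0)) \<and>
     (\<forall>x\<in>S. \<forall>c. p (c *\<^sub>R x) = \<bar>c\<bar> * p x) \<and>
     (\<forall>x\<in>S. \<forall>y\<in>S. p (x + y) \<le> p x + p y)"

definition equivalent_norms_on :: "'a set \<Rightarrow> ('a \<Rightarrow> real) \<Rightarrow> ('a \<Rightarrow> real) \<Rightarrow> bool" where
  "equivalent_norms_on S p q \<longleftrightarrow>
     (\<exists>c>0. \<forall>x\<in>S. p x \<le> c * q x) \<and> (\<exists>c>0. \<forall>x\<in>S. q x \<le> c * p x)"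

definition unit_ball_on :: "'a set \<Rightarrow> ('a \<Rightarrow> real) \<Rightarrow> 'a set" where
  "unit_ball_on S p = {x\<in>S. p x \<le> 1}"

definition unit_sphere_on :: "'a set \<Rightarrow> ('a \<Rightarrow> real) \<Rightarrow> 'a set" where
  "unit_sphere_on S p = {x\<in>S. p x = 1}"

text \<open>The real supremum below is meaningful only if the unit ball is bounded in the Hilbertian norm
  (it is nonempty, containing \<open>0\<close>), as is the case when \<open>p\<close> is equivalent to the latter on \<open>S\<close>.\<close>

definition dual_norm_on :: "'a::real_inner set \<Rightarrow> ('a \<Rightarrow> real) \<Rightarrow> 'a \<Rightarrow> real" where
  "dual_norm_on S p y = (SUP x\<in>unit_ball_on S p. x \<bullet> y)"

text \<open>The library's \<open>closest_point\<close> is restricted to Heine-Borel spaces, hence to finite dimension.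
  For a closed subspace \<open>S\<close> of a Hilbert space, the description below is uniquely satisfied.\<close>

definition orthogonal_projection :: "'a::real_inner set \<Rightarrow> 'a \<Rightarrow> 'a" where
  "orthogonal_projection S x = (THE p. p \<in> S \<and> (\<forall>s\<in>S. orthogonal (x - p) s))"

text \<open>On \<open>ereal\<close>, the library's addition satisfies \<open>\<infinity> + (-\<infinity>) = \<infinity>\<close>; the lower addition takes
  the value \<open>-\<infinity>\<close> instead.\<close>

definition lower_add :: "ereal \<Rightarrow> ereal \<Rightarrow> ereal" where
  "lower_add a b = (if a = -\<infinity> \<or> b = -\<infinity> then -\<infinity> else a + b)"

definition fenchel_conjugate :: "('a::real_inner \<Rightarrow> ereal) \<Rightarrow> 'a \<Rightarrow> ereal" where
  "fenchel_conjugate f y = (SUP x. lower_add (ereal (x \<bullet> y)) (- f x))"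

definition infimal_postcomp :: "'a set \<Rightarrow> ('a \<Rightarrow> 'b) \<Rightarrow> ('a \<Rightarrow> ereal) \<Rightarrow> 'b \<Rightarrow> ereal" where
  "infimal_postcomp W \<theta> h v = (INF w\<in>{w\<in>W. \<theta> w = v}. h w)"

definition effective_dom :: "('a \<Rightarrow> ereal) \<Rightarrow> 'a set" where
  "effective_dom f = {x. f x < \<infinity>}"

definition proper_fun :: "('a \<Rightarrow> ereal) \<Rightarrow> bool" where
  "proper_fun f \<longleftrightarrow> effective_dom f \<noteq> {} \<and> (\<forall>x. f x \<noteq> -\<infinity>)"

definition has_min_on :: "('a \<Rightarrow> ereal) \<Rightarrow> 'a set \<Rightarrow> ereal \<Rightarrow> bool" where
  "has_min_on f X m \<longleftrightarrow> m \<in> f ` X \<and> (\<forall>x\<in>X. m \<le> f x)"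

end

theory Submission
  imports Defs
begin

text \<open>The norm is the infimal convolution of the local norms. In place of weak compactness we use that
  a decreasing sequence of bounded convex sets in a finite power of a Hilbert space has a coordinatewise
  convergent selection: by the parallelogram law, elements of almost minimal norm form a Cauchy sequence.
  Applied to almost optimal decompositions, this shows that the infimum in the convolution is attained
  and that the unit ball is closed. Applied to sublevel sets, it shows that a conjugate attains its
  minimum on a closed bounded convex set. The lower bound itself holds because \<open>\<theta>\<^sub>j\<close> maps \<open>W\<^sub>j\<close> into
  the unit ball, conjugation reverses the order, and a biconjugate is below the function.\<close>

section \<open>Nested convex sets in a Hilbert space\<close>

text \<open>The least energies \<open>d n\<close> increase along the sets and stay below
  \<open>B\<close>, so they converge. Near-minimizers taken at levels \<open>n \<le> m\<close> both
  lie in \<open>C n\<close>, hence so does their midpoint, and the parallelogram law turns the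
  almost equal energies into a small distance. Only midpoints enter, which is why \<open>mid\<close>
  is the form of convexity assumed. The sets are not assumed closed, so membership of
  \<open>u\<close> is left to each application.\<close>

lemma nested_convex_selection:
  fixes C :: "nat \<Rightarrow> ('j \<Rightarrow> 'a::{real_inner, complete_space}) set"
  assumes "finite J"
    and dec: "decseq C"
    and ne: "\<And>n. C n \<noteq> {}"
    and mid: "\<And>n x y. x \<in> C n \<Longrightarrow> y \<in> C n \<Longrightarrow> (\<lambda>j. (1/2) *\<^sub>R (x j + y j)) \<in> C n"
    and bounded: "\<And>x. x \<in> C 0 \<Longrightarrow> (\<Sum>j\<in>J. (norm (x j))\<^sup>2) \<le> B"
  obtains s u where "\<And>n. s n \<in> C n" "\<And>j. j \<in> J \<Longrightarrow> (\<lambda>n. s n j) \<longlonglongrightarrow> u j"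
proof -
  \<comment> \<open>\<open>q\<close> is the squared norm of the Hilbert sum of the coordinates in
    \<open>J\<close>; other coordinates are ignored.\<close>
  define q where "q x = (\<Sum>j\<in>J. (norm (x j))\<^sup>2)" for x :: "'j \<Rightarrow> 'a"
  define d where "d n = Inf (q ` C n)" for n
  define r where "r n = inverse (real (Suc n))" for n
  have q0: "0 \<le> q x" for x
    by (simp add: q_def sum_nonneg)
  have bdd: "bdd_below (q ` A)" for A
    using q0 by (auto intro!: bdd_belowI[of _ 0])
  have sub: "C n \<subseteq> C m" if "m \<le> n" for m n
    using dec that by (auto simp: decseq_def)
  have d_le: "d n \<le> q x" if "x \<in> C n" for n x
    unfolding d_def using that by (intro cInf_lower bdd) auto
  have "incseq d"
    unfolding incseq_def d_def
    using sub ne by (intro allI impI cInf_superset_mono bdd image_mono) auto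
  moreover have "\<forall>n. d n \<le> B"
  proof
    fix n
    obtain x where "x \<in> C n" using ne by blast
    then show "d n \<le> B"
      using d_le[of x n] bounded[of x] sub[of 0 n] by (auto simp: q_def)
  qed
  ultimately obtain D where D: "d \<longlonglongrightarrow> D" "\<And>n. d n \<le> D"
    using incseq_convergent[of d B] by blast
  have "\<exists>x\<in>C n. q x < d n + r n" for n
    using cInf_lessD[of "q ` C n" "d n + r n"] ne[of n] by (auto simp: d_def r_def)
  then obtain s where s: "\<And>n. s n \<in> C n" "\<And>n. q (s n) < d n + r n"
    by metis
  have diff: "(norm (s n j - s m j))\<^sup>2 \<le> 2 * (D - d n) + 4 * r n"
    if "n \<le> m" "j \<in> J" for n m j
  proof -
    define c where "c = (\<lambda>j. (1/2) *\<^sub>R (s n j + s m j))"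
    have "c \<in> C n"
      unfolding c_def using s(1) sub[OF \<open>n \<le> m\<close>] by (intro mid) auto
    then have "d n \<le> q c" by (rule d_le)
    have parallelogram: "(norm (x - y))\<^sup>2 = 2 * (norm x)\<^sup>2 + 2 * (norm y)\<^sup>2
        - 4 * (norm ((1/2) *\<^sub>R (x + y)))\<^sup>2" for x y :: 'a
      unfolding power2_norm_eq_inner by (simp add: inner_simps inner_commute field_simps)
    have "(norm (s n j - s m j))\<^sup>2 \<le> (\<Sum>j\<in>J. (norm (s n j - s m j))\<^sup>2)"
      using that \<open>finite J\<close> by (intro member_le_sum) auto
    also have "\<dots> = 2 * q (s n) + 2 * q (s m) - 4 * q c"
      unfolding q_def c_def parallelogram
      by (simp add: sum.distrib sum_subtractf sum_distrib_left)
    \<comment> \<open>The energies contribute \<open>2 * d n + 2 * d m - 4 * d n\<close>, and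
      \<open>d m \<le> D\<close>. Replacing \<open>r m\<close> by \<open>r n\<close> next makes the
      bound depend on \<open>n\<close> alone, as the Cauchy property requires.\<close>
    also have "\<dots> \<le> 2 * (D - d n) + 2 * r n + 2 * r m"
      using s(2)[of n] s(2)[of m] \<open>d n \<le> q c\<close> D(2)[of m] by argo
    also have "\<dots> \<le> 2 * (D - d n) + 4 * r n"
    proof -
      have "r m \<le> r n" using \<open>n \<le> m\<close> by (simp add: r_def field_simps)
      then show ?thesis by simp
    qed
    finally show ?thesis .
  qed
  have "(\<lambda>n. 2 * (D - d n) + 4 * r n) \<longlonglongrightarrow> 2 * (D - D) + 4 * 0"
    unfolding r_def by (intro tendsto_intros D LIMSEQ_inverse_real_of_nat)
  then have lim: "(\<lambda>n. 2 * (D - d n) + 4 * r n) \<longlonglongrightarrow> 0" by simp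
  have "convergent (\<lambda>n. s n j)" if "j \<in> J" for j
  proof (rule Cauchy_convergent, rule CauchyI')
    fix e :: real
    assume "0 < e"
    then have "\<forall>\<^sub>F n in sequentially. 2 * (D - d n) + 4 * r n < e\<^sup>2"
      by (intro order_tendstoD(2)[OF lim]) simp
    then obtain M where M: "\<And>n. M \<le> n \<Longrightarrow> 2 * (D - d n) + 4 * r n < e\<^sup>2"
      unfolding eventually_sequentially by blast
    have "norm (s m j - s n j) < e" if "M \<le> m" "m < n" for m n
      using diff[of m n j] M[of m] that \<open>j \<in> J\<close> \<open>0 < e\<close>
      by (intro power2_less_imp_less[of _ e]) auto
    then show "\<exists>M. \<forall>m\<ge>M. \<forall>n>m. dist (s m j) (s n j) < e"
      unfolding dist_norm by blast
  qed
  then have "\<And>j. j \<in> J \<Longrightarrow> (\<lambda>n. s n j) \<longlonglongrightarrow> lim (\<lambda>n. s n j)"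
    by (simp add: convergent_LIMSEQ_iff)
  with s(1) show thesis by (rule that)
qed

text \<open>Convexity replaces the compactness that bounded closed sets may lack in infinite
  dimension. From index \<open>n\<close> on the selected sequence stays in \<open>C n\<close>, so
  closedness puts its limit there.\<close>

lemma nested_convex_Inter_nonempty:
  fixes C :: "nat \<Rightarrow> 'a::{real_inner, complete_space} set"
  assumes dec: "decseq C" and ne: "\<And>n. C n \<noteq> {}"
    and "\<And>n. closed (C n)" "\<And>n. convex (C n)" "bounded (C 0)"
  obtains x where "\<And>n. x \<in> C n"
proof -
  obtain B where B: "\<And>x. x \<in> C 0 \<Longrightarrow> norm x \<le> B"
    using \<open>bounded (C 0)\<close> by (auto simp: bounded_iff)
  \<comment> \<open>The selection is used with a single coordinate, indexed by
    \<open>unit\<close>.\<close>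
  define C' where "C' n = {u :: unit \<Rightarrow> 'a. u () \<in> C n}" for n
  have dec': "decseq C'"
    using dec by (auto simp: C'_def decseq_def)
  have ne': "C' n \<noteq> {}" for n
    using ne[of n] by (auto simp: C'_def)
  have mid: "(\<lambda>j. (1/2) *\<^sub>R (x j + y j)) \<in> C' n" if "x \<in> C' n" "y \<in> C' n" for n x y
    using convexD[OF \<open>convex (C n)\<close>, of "x ()" "y ()" "1/2" "1/2"] that
    by (simp add: C'_def scaleR_add_right)
  have bound: "(\<Sum>j\<in>UNIV. (norm (x j))\<^sup>2) \<le> B\<^sup>2" if "x \<in> C' 0" for x
    using that B by (simp add: C'_def UNIV_unit power_mono)
  obtain s u where s: "\<And>n. s n \<in> C' n" and u: "\<And>j. (\<lambda>n. s n j) \<longlonglongrightarrow> u j"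
    by (rule nested_convex_selection[OF finite_class.finite_UNIV dec' ne' mid bound]) auto
  have "u () \<in> C n" for n
  proof (rule Lim_in_closed_set[OF \<open>closed (C n)\<close> _ _ u])
    show "\<forall>\<^sub>F k in sequentially. s k () \<in> C n"
      using s dec by (intro eventually_sequentiallyI[of n]) (auto simp: C'_def decseq_def)
  qed simp
  then show thesis by (rule that)
qed

section \<open>Metric and orthogonal projections\<close>

text \<open>The points of \<open>S\<close> whose distance to \<open>a\<close> exceeds the infimum by
  at most \<open>1/(n+1)\<close> form nested bounded closed convex sets; a point common to all of
  them is closest.\<close>

lemma closest_point_exists_complete:
  fixes S :: "'a::{real_inner, complete_space} set"
  assumes "closed S" "convex S" "S \<noteq> {}"
  obtains q where "q \<in> S" "\<And>z. z \<in> S \<Longrightarrow> dist a q \<le> dist a z"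
proof -
  define C where "C n = S \<inter> cball a (infdist a S + inverse (Suc n))" for n
  have "decseq C"
    unfolding C_def by (intro decseq_SucI Int_mono subset_cball) (auto simp: field_simps)
  moreover have "C n \<noteq> {}" for n
  proof -
    have "\<exists>x\<in>S. dist a x < infdist a S + inverse (Suc n)"
      using cInf_lessD[of "dist a ` S" "infdist a S + inverse (Suc n)"] \<open>S \<noteq> {}\<close>
      by (auto simp: infdist_notempty)
    then show ?thesis by (force simp: C_def)
  qed
  moreover have "closed (C n)" "convex (C n)" "bounded (C 0)" for n
    using assms by (auto simp: C_def intro!: convex_Int closed_Int bounded_Int)
  ultimately obtain q where q: "\<And>n. q \<in> C n"
    using nested_convex_Inter_nonempty by metis
  have "dist a q \<le> infdist a S + 0"
  proof (rule LIMSEQ_le_const)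
    show "(\<lambda>n. infdist a S + inverse (real (Suc n))) \<longlonglongrightarrow> infdist a S + 0"
      by (intro tendsto_intros LIMSEQ_inverse_real_of_nat)
    show "\<exists>N. \<forall>n\<ge>N. dist a q \<le> infdist a S + inverse (real (Suc n))"
      using q by (auto simp: C_def)
  qed
  then have "dist a q \<le> dist a z" if "z \<in> S" for z
    using infdist_le[OF that, of a] by simp
  with q[of 0] show thesis by (intro that) (auto simp: C_def)
qed

text \<open>A closest point makes an obtuse angle with every direction of \<open>S\<close>; testing
  \<open>s\<close> and \<open>- s\<close> gives orthogonality. The second fact lets a pairing with a
  vector of \<open>S\<close> ignore the projection, which is how the dual norms are compared
  later.\<close>

lemma orthogonal_projection:
  fixes S :: "'a::{real_inner, complete_space} set"
  assumes "closed S" "subspace S"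
  shows orthogonal_projection_in: "orthogonal_projection S x \<in> S"
    and inner_orthogonal_projection: "s \<in> S \<Longrightarrow> s \<bullet> orthogonal_projection S x = s \<bullet> x"
proof -
  have cvx: "convex S" "S \<noteq> {}"
    using assms subspace_imp_convex subspace_0 by auto
  obtain q where q: "q \<in> S" "\<And>z. z \<in> S \<Longrightarrow> dist x q \<le> dist x z"
    by (rule closest_point_exists_complete[OF \<open>closed S\<close> cvx]) blast
  have le: "(x - q) \<bullet> s \<le> 0" if "s \<in> S" for s
    using any_closest_point_dot[of S q "q + s" x] cvx assms q that
    by (simp add: subspace_add)
  have orth: "orthogonal (x - q) s" if "s \<in> S" for s
    using le[OF that] le[of "- s"] that assms by (simp add: orthogonal_def subspace_neg)
  \<comment> \<open>The definite description needs uniqueness: the difference of two candidates lies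
    in \<open>S\<close> and is orthogonal to itself.\<close>
  have "\<exists>!q. q \<in> S \<and> (\<forall>s\<in>S. orthogonal (x - q) s)"
  proof (rule ex1I[of _ q])
    fix r
    assume r: "r \<in> S \<and> (\<forall>s\<in>S. orthogonal (x - r) s)"
    then have "r - q \<in> S"
      using q assms by (simp add: subspace_diff)
    then have "(x - r) \<bullet> (r - q) = 0" "(x - q) \<bullet> (r - q) = 0"
      using r orth by (auto simp: orthogonal_def)
    then have "(r - q) \<bullet> (r - q) = 0"
      by (simp add: inner_diff_left)
    then show "r = q" by simp
  qed (use q orth in blast)
  from theI'[OF this] have
    *: "orthogonal_projection S x \<in> S" "\<And>s. s \<in> S \<Longrightarrow> orthogonal (x - orthogonal_projection S x) s"
    by (auto simp: orthogonal_projection_def)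
  show "orthogonal_projection S x \<in> S" by (rule *)
  show "s \<bullet> orthogonal_projection S x = s \<bullet> x" if "s \<in> S"
    using *(2)[OF that] by (simp add: orthogonal_def inner_diff_right inner_commute[of _ s])
qed

lemma subspace_closed_span: "subspace (closed_span W)"
  unfolding subspace_def
proof (intro conjI ballI allI)
  show "0 \<in> closed_span W"
    unfolding closed_span_def using closure_subset span_0 by blast
next
  fix x y
  assume "x \<in> closed_span W" "y \<in> closed_span W"
  then obtain f g where "\<forall>n. f n \<in> span W" "f \<longlonglongrightarrow> x" "\<forall>n. g n \<in> span W" "g \<longlonglongrightarrow> y"
    unfolding closed_span_def closure_sequential by blast
  then have "\<forall>n. f n + g n \<in> span W" "(\<lambda>n. f n + g n) \<longlonglongrightarrow> x + y"
    by (auto intro: span_add tendsto_add)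
  then show "x + y \<in> closed_span W"
    unfolding closed_span_def closure_sequential by (intro exI conjI)
next
  fix c x
  assume "x \<in> closed_span W"
  then obtain f where "\<forall>n. f n \<in> span W" "f \<longlonglongrightarrow> x"
    unfolding closed_span_def closure_sequential by blast
  then have "\<forall>n. c *\<^sub>R f n \<in> span W" "(\<lambda>n. c *\<^sub>R f n) \<longlonglongrightarrow> c *\<^sub>R x"
    by (auto intro: span_scale tendsto_intros)
  then show "c *\<^sub>R x \<in> closed_span W"
    unfolding closed_span_def closure_sequential by (intro exI conjI)
qed

section \<open>Conjugates\<close>

text \<open>For finite \<open>c\<close> and \<open>a\<close> the set is a closed half-space; an
  infinite value of either makes it empty or the whole space.\<close>

lemma closed_convex_affine_sublevel:
  fixes y :: "'a::real_inner"
  shows "closed {x. lower_add (ereal (x \<bullet> y)) c \<le> a} \<and> convex {x. lower_add (ereal (x \<bullet> y)) c \<le> a}"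
proof -
  have "{x. lower_add (ereal (x \<bullet> y)) c \<le> a} \<in> {UNIV, {}} \<union> range (\<lambda>b. {x. y \<bullet> x \<le> b})"
  proof (cases c)
    case (real r)
    show ?thesis
    proof (cases a)
      case (real b)
      have "{x. lower_add (ereal (x \<bullet> y)) c \<le> a} = {x. y \<bullet> x \<le> b - r}"
        using real \<open>c = ereal r\<close> by (auto simp: lower_add_def inner_commute)
      then show ?thesis by blast
    qed (use real in \<open>auto simp: lower_add_def\<close>)
  qed (cases a; auto simp: lower_add_def)+
  then show ?thesis
    by (auto simp: closed_halfspace_le convex_halfspace_le)
qed

text \<open>A conjugate is a supremum of the functions of the preceding lemma, so its sublevel sets
  are closed and convex for arbitrary \<open>f\<close>. A point common to the sublevel sets along a
  minimizing sequence attains the infimum, be it finite or not.\<close>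

lemma fenchel_conjugate_attains_min:
  fixes f :: "'a::{real_inner, complete_space} \<Rightarrow> ereal"
  assumes "closed K" "convex K" "bounded K" "K \<noteq> {}"
  shows "has_min_on (fenchel_conjugate f) K (INF x\<in>K. fenchel_conjugate f x)"
proof -
  let ?g = "fenchel_conjugate f"
  \<comment> \<open>The \<open>a i\<close> are values attained on \<open>K\<close>, which makes
    every \<open>C n\<close> below nonempty.\<close>
  obtain a where a: "decseq a" "range a \<subseteq> ?g ` K" "(INF x\<in>K. ?g x) = (INF i. a i)"
    using Inf_countable_INF[of "?g ` K"] \<open>K \<noteq> {}\<close> by auto
  define C where "C n = K \<inter> {x. ?g x \<le> a n}" for n :: nat
  have sublevel: "{x. ?g x \<le> b} = (\<Inter>y. {x. lower_add (ereal (x \<bullet> y)) (- f y) \<le> b})" for b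
    by (auto simp: fenchel_conjugate_def SUP_le_iff inner_commute)
  have "decseq C"
    using a(1) by (force simp: C_def decseq_def intro: order_trans)
  moreover have "C n \<noteq> {}" for n
  proof -
    have "a n \<in> ?g ` K" using a(2) by blast
    then show ?thesis by (auto simp: C_def)
  qed
  moreover have "closed (C n)" "convex (C n)" for n
    using assms closed_convex_affine_sublevel unfolding C_def sublevel
    by (blast intro: closed_Int convex_Int closed_INT convex_INT)+
  moreover have "bounded (C 0)"
    using assms by (auto simp: C_def intro: bounded_Int)
  ultimately obtain x where x: "\<And>n. x \<in> C n"
    using nested_convex_Inter_nonempty by metis
  have "x \<in> K" "?g x \<le> (INF i. a i)"
    using x by (auto simp: C_def intro: INF_greatest)
  then have "?g x = (INF x\<in>K. ?g x)"
    using a(3) by (intro antisym INF_lower) auto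
  with \<open>x \<in> K\<close> show ?thesis
    unfolding has_min_on_def by (metis INF_lower imageI)
qed

lemma fenchel_conjugate_antimono:
  assumes "\<And>y. f y \<le> g y"
  shows "fenchel_conjugate g x \<le> fenchel_conjugate f x"
  unfolding fenchel_conjugate_def
proof (rule SUP_mono')
  fix y
  have "- g y \<le> - f y" using assms by simp
  then show "lower_add (ereal (y \<bullet> x)) (- g y) \<le> lower_add (ereal (y \<bullet> x)) (- f y)"
    unfolding lower_add_def by (auto intro: add_left_mono)
qed

lemma fenchel_biconjugate_le: "fenchel_conjugate (fenchel_conjugate f) x \<le> f x"
  unfolding fenchel_conjugate_def[of "fenchel_conjugate f"]
proof (rule SUP_least)
  fix y
  \<comment> \<open>This is the Fenchel-Young inequality. Infinite values survive the rearrangement: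
    if \<open>f x\<close> is \<open>-\<infinity>\<close>, the conjugate is
    \<open>\<infinity>\<close> at \<open>y\<close> and the left side of the goal is
    \<open>-\<infinity>\<close>.\<close>
  have "lower_add (ereal (x \<bullet> y)) (- f x) \<le> fenchel_conjugate f y"
    unfolding fenchel_conjugate_def by (rule SUP_upper) simp
  then show "lower_add (ereal (y \<bullet> x)) (- fenchel_conjugate f y) \<le> f x"
    by (cases "f x"; cases "fenchel_conjugate f y") (auto simp: lower_add_def inner_commute)
qed

section \<open>Dual norms\<close>

lemma norm_onD:
  assumes "norm_on S q"
  shows norm_on_nonneg: "x \<in> S \<Longrightarrow> 0 \<le> q x"
    and norm_on_eq_0: "x \<in> S \<Longrightarrow> q x = 0 \<longleftrightarrow> x = 0"
    and norm_on_scaleR: "x \<in> S \<Longrightarrow> q (c *\<^sub>R x) = \<bar>c\<bar> * q x"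
    and norm_on_triangle: "x \<in> S \<Longrightarrow> y \<in> S \<Longrightarrow> q (x + y) \<le> q x + q y"
  using assms by (auto simp: norm_on_def)

lemma norm_le_of_unit_ball_on:
  assumes "norm_on S q" and "\<And>x. x \<in> S \<Longrightarrow> norm x \<le> c * q x" and "x \<in> unit_ball_on S q"
  shows "norm x \<le> \<bar>c\<bar>"
proof -
  have "x \<in> S" "0 \<le> q x" "q x \<le> 1"
    using assms by (auto simp: unit_ball_on_def norm_on_nonneg)
  then have "norm x \<le> c * q x" "c * q x \<le> \<bar>c\<bar> * q x" "\<bar>c\<bar> * q x \<le> \<bar>c\<bar>"
    using assms by (auto intro: mult_right_mono mult_left_le)
  then show ?thesis by linarith
qed

text \<open>Cauchy-Schwarz on a norm-bounded ball; this makes the real supremum in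
  \<open>dual_norm_on\<close> meaningful.\<close>

lemma bdd_above_inner_unit_ball_on:
  assumes "norm_on S q" and le: "\<And>x. x \<in> S \<Longrightarrow> norm x \<le> c * q x"
  shows "bdd_above ((\<lambda>x. x \<bullet> y) ` unit_ball_on S q)"
proof (rule bdd_aboveI2)
  fix x
  assume x: "x \<in> unit_ball_on S q"
  have "norm x \<le> \<bar>c\<bar>"
    by (intro norm_le_of_unit_ball_on[OF assms(1) le x])
  then show "x \<bullet> y \<le> \<bar>c\<bar> * norm y"
    by (meson mult_right_mono norm_cauchy_schwarz norm_ge_zero order_trans)
qed

text \<open>Dividing a nonzero \<open>x\<close> by \<open>q x\<close> brings it into the unit ball,
  where the supremum applies.\<close>

lemma inner_le_norm_mult_dual_norm_on:
  assumes "subspace S" "norm_on S q" and le: "\<And>x. x \<in> S \<Longrightarrow> norm x \<le> c * q x" and "x \<in> S"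
  shows "x \<bullet> y \<le> q x * dual_norm_on S q y"
proof (cases "x = 0")
  case True
  then show ?thesis using norm_on_eq_0[OF assms(2,4)] by simp
next
  case False
  then have pos: "0 < q x"
    using norm_on_nonneg[OF assms(2,4)] norm_on_eq_0[OF assms(2,4)] by simp
  have "inverse (q x) *\<^sub>R x \<in> unit_ball_on S q"
    using assms pos by (simp add: unit_ball_on_def subspace_scale norm_on_scaleR[OF assms(2)])
  then have "(inverse (q x) *\<^sub>R x) \<bullet> y \<le> dual_norm_on S q y"
    unfolding dual_norm_on_def
    by (rule cSUP_upper) (rule bdd_above_inner_unit_ball_on[OF assms(2) le])
  with pos show ?thesis by (simp add: field_simps)
qed

lemma norm_on_dual_norm_on:
  assumes "subspace S" "norm_on S q" and le: "\<And>x. x \<in> S \<Longrightarrow> norm x \<le> c * q x"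
  shows "norm_on S (dual_norm_on S q)"
proof -
  let ?B = "unit_ball_on S q" and ?D = "dual_norm_on S q"
  note bdd = bdd_above_inner_unit_ball_on[OF assms(2) le]
  have B0: "0 \<in> ?B"
    using assms norm_on_eq_0[OF assms(2), of 0] by (simp add: unit_ball_on_def subspace_0)
  have upper: "x \<bullet> y \<le> ?D y" if "x \<in> ?B" for x y
    unfolding dual_norm_on_def by (rule cSUP_upper[OF that bdd])
  have least: "?D y \<le> b" if "\<And>x. x \<in> ?B \<Longrightarrow> x \<bullet> y \<le> b" for y b
    unfolding dual_norm_on_def using B0 that by (intro cSUP_least) auto
  have nonneg: "0 \<le> ?D y" for y
    using upper[OF B0, of y] by simp
  \<comment> \<open>Symmetry of the ball upgrades \<open>upper\<close> to a bound on
    \<open>\<bar>x \<bullet> y\<bar>\<close>, hence to scalars of either sign.\<close>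
  have neg: "- x \<in> ?B" if "x \<in> ?B" for x
    using that norm_on_scaleR[OF assms(2), of x "-1"] assms(1)
    by (auto simp: unit_ball_on_def subspace_neg)
  have scale_le: "?D (r *\<^sub>R y) \<le> \<bar>r\<bar> * ?D y" for r y
  proof (rule least)
    fix x
    assume "x \<in> ?B"
    then have "\<bar>x \<bullet> y\<bar> \<le> ?D y"
      using upper[of x y] upper[OF neg, of x y] by simp
    then have "\<bar>r\<bar> * \<bar>x \<bullet> y\<bar> \<le> \<bar>r\<bar> * ?D y"
      by (rule mult_left_mono) simp
    then show "x \<bullet> r *\<^sub>R y \<le> \<bar>r\<bar> * ?D y"
      by (metis abs_le_D1 abs_mult inner_scaleR_right)
  qed
  have scale: "?D (r *\<^sub>R y) = \<bar>r\<bar> * ?D y" for r y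
  proof (cases "r = 0")
    case True
    have "?D 0 \<le> 0" by (rule least) simp
    with True nonneg[of 0] show ?thesis by simp
  next
    case False
    \<comment> \<open>The reverse inequality is \<open>scale_le\<close> for the scalar
      \<open>inverse r\<close> and the vector \<open>r *\<^sub>R y\<close>.\<close>
    have "\<bar>r\<bar> * ?D y \<le> \<bar>r\<bar> * (\<bar>inverse r\<bar> * ?D (r *\<^sub>R y))"
      using scale_le[of "inverse r" "r *\<^sub>R y"] False by (intro mult_left_mono) auto
    also have "\<dots> = ?D (r *\<^sub>R y)"
      using False by (simp add: abs_inverse)
    finally show ?thesis using scale_le[of r y] by simp
  qed
  have triangle: "?D (x + y) \<le> ?D x + ?D y" for x y
    by (rule least) (simp add: inner_add_right add_mono upper)
  \<comment> \<open>Definiteness tests \<open>y\<close> against itself, which requires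
    \<open>y \<in> S\<close>.\<close>
  have "y = 0" if "y \<in> S" "?D y = 0" for y
    using inner_le_norm_mult_dual_norm_on[OF assms(1,2) le that(1), of y] that(2)
    by (metis inner_gt_zero_iff mult_zero_right not_less)
  with nonneg scale triangle scale[of 0 0] show ?thesis
    unfolding norm_on_def by auto
qed

section \<open>Infimal convolution of local norms\<close>

text \<open>Only the subspaces and their norms are fixed here: the norm, its ball and its dual
  depend on nothing else. The sets \<open>W j\<close>, the maps \<open>\<theta> j\<close> and
  \<open>h\<close> enter with the lower bound.\<close>

locale local_norms =
  fixes J :: "'j set"
    and V :: "'j \<Rightarrow> 'a::{real_inner, complete_space} set"
    and p :: "'j \<Rightarrow> 'a \<Rightarrow> real"
  assumes finite_J: "finite J" and J_nonempty: "J \<noteq> {}"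
    and subspace_V: "j \<in> J \<Longrightarrow> subspace (V j)"
    and closed_V: "j \<in> J \<Longrightarrow> closed (V j)"
    and sum_V: "(\<Sum>j\<in>J. V j) = UNIV"
    and norm_on_p: "j \<in> J \<Longrightarrow> norm_on (V j) (p j)"
    and equivalent_p: "j \<in> J \<Longrightarrow> equivalent_norms_on (V j) (p j) norm"
begin

definition decompositions :: "'a \<Rightarrow> ('j \<Rightarrow> 'a) set" where
  "decompositions v = {u. (\<forall>j\<in>J. u j \<in> V j) \<and> (\<Sum>j\<in>J. u j) = v}"

definition inf_norm :: "'a \<Rightarrow> real" where
  "inf_norm v = (INF u\<in>decompositions v. \<Sum>j\<in>J. p j (u j))"

text \<open>This is \<open>sum_V\<close> read through the description of a Minkowski sum; with the
  lower bound 0 it makes the infimum in \<open>inf_norm\<close> a genuine one.\<close>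

lemma decompositions_nonempty: "decompositions v \<noteq> {}"
proof -
  have "v \<in> {sum u J |u. \<forall>j\<in>J. u j \<in> V j}"
    using sum_V set_sum_alt[OF finite_J, of V] by simp
  then show ?thesis by (auto simp: decompositions_def)
qed

lemma sum_p_nonneg: "u \<in> decompositions v \<Longrightarrow> 0 \<le> (\<Sum>j\<in>J. p j (u j))"
  by (intro sum_nonneg) (auto simp: decompositions_def intro: norm_on_nonneg[OF norm_on_p])

lemma p_0: "j \<in> J \<Longrightarrow> p j 0 = 0"
  using norm_on_eq_0[OF norm_on_p] subspace_V subspace_0 by metis

lemma zero_in_unit_ball_p: "j \<in> J \<Longrightarrow> 0 \<in> unit_ball_on (V j) (p j)"
  using p_0 subspace_V by (simp add: unit_ball_on_def subspace_0)

lemma inf_norm_le: "u \<in> decompositions v \<Longrightarrow> inf_norm v \<le> (\<Sum>j\<in>J. p j (u j))"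
  unfolding inf_norm_def
  by (rule cINF_lower) (auto intro!: bdd_belowI[of _ 0] sum_p_nonneg)

lemma norm_le_p: obtains c where "0 < c" "\<And>j x. j \<in> J \<Longrightarrow> x \<in> V j \<Longrightarrow> norm x \<le> c * p j x"
proof -
  have "\<forall>j\<in>J. \<exists>c>0. \<forall>x\<in>V j. norm x \<le> c * p j x"
    using equivalent_p by (auto simp: equivalent_norms_on_def)
  then obtain c where c: "\<And>j. j \<in> J \<Longrightarrow> 0 < c j"
      "\<And>j x. j \<in> J \<Longrightarrow> x \<in> V j \<Longrightarrow> norm x \<le> c j * p j x"
    by metis
  show thesis
  proof
    \<comment> \<open>The sum of the finitely many positive local constants dominates each of them
      and so serves all \<open>j\<close> at once.\<close>
    show "0 < (\<Sum>j\<in>J. c j)"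
      using c finite_J J_nonempty by (intro sum_pos) auto
    fix j x
    assume jx: "j \<in> J" "x \<in> V j"
    have "c j \<le> (\<Sum>j\<in>J. c j)"
      using c finite_J jx by (intro member_le_sum) (auto intro: less_imp_le)
    then have "c j * p j x \<le> (\<Sum>j\<in>J. c j) * p j x"
      using norm_on_nonneg[OF norm_on_p] jx by (intro mult_right_mono) auto
    with c(2)[OF jx] show "norm x \<le> (\<Sum>j\<in>J. c j) * p j x" by linarith
  qed
qed

text \<open>By the reverse triangle inequality and the equivalence of norms, \<open>p j\<close> is
  Lipschitz on \<open>V j\<close> for the Hilbertian norm.\<close>

lemma tendsto_p:
  assumes "j \<in> J" "\<And>n. x n \<in> V j" "l \<in> V j" "x \<longlonglongrightarrow> l"
  shows "(\<lambda>n. p j (x n)) \<longlonglongrightarrow> p j l"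
proof -
  obtain c where c: "\<And>x. x \<in> V j \<Longrightarrow> p j x \<le> c * norm x"
    using equivalent_p[OF assms(1)] by (auto simp: equivalent_norms_on_def)
  note sub = subspace_V[OF assms(1)] and nrm = norm_on_p[OF assms(1)]
  have "\<bar>p j (x n) - p j l\<bar> \<le> c * norm (x n - l)" for n
  proof -
    have d: "x n - l \<in> V j"
      using assms sub by (simp add: subspace_diff)
    have "p j (x n) \<le> p j (x n - l) + p j l"
      using norm_on_triangle[OF nrm d assms(3)] by simp
    moreover have "p j l \<le> p j (- (x n - l)) + p j (x n)"
      using norm_on_triangle[OF nrm subspace_neg[OF sub d] assms(2)[of n]] by simp
    moreover have "p j (- (x n - l)) = p j (x n - l)"
      using norm_on_scaleR[OF nrm d, of "-1"] by simp
    ultimately show ?thesis using c[OF d] by linarith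
  qed
  then have le: "\<forall>\<^sub>F n in sequentially. norm (p j (x n) - p j l) \<le> c * norm (x n - l)"
    by simp
  have "(\<lambda>n. c * norm (x n - l)) \<longlonglongrightarrow> c * norm (l - l)"
    by (intro tendsto_intros assms)
  then have "(\<lambda>n. p j (x n) - p j l) \<longlonglongrightarrow> 0"
    by (intro Lim_null_comparison[OF le]) simp
  then show ?thesis by (rule LIM_zero_cancel)
qed

section \<open>Attainment of the infimum and norm axioms\<close>

text \<open>The compactness step of the convolution: approximate decompositions of nearby points
  yield an exact one. It serves with \<open>x = v\<close> for attainment and with
  \<open>a = 1\<close> for closedness of the ball.\<close>

lemma decomposition_of_approximate:
  assumes "\<And>e. 0 < e \<Longrightarrow> \<exists>x. norm (x - v) \<le> e \<and> (\<exists>u\<in>decompositions x. (\<Sum>j\<in>J. p j (u j)) \<le> a + e)"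
  obtains u where "u \<in> decompositions v" "(\<Sum>j\<in>J. p j (u j)) \<le> a"
proof -
  obtain c where c: "0 < c" "\<And>j x. j \<in> J \<Longrightarrow> x \<in> V j \<Longrightarrow> norm x \<le> c * p j x"
    by (rule norm_le_p) blast
  define e where "e n = inverse (real (Suc n))" for n
  have e: "e \<longlonglongrightarrow> 0" "\<And>n. 0 < e n"
    unfolding e_def by (rule LIMSEQ_inverse_real_of_nat) simp
  \<comment> \<open>Both constraints, on the sum and on the cost, are relaxed by \<open>e n\<close>;
    the sets are then nonempty by assumption, nested and stable under midpoints.\<close>
  define C where "C n = {u. (\<forall>j\<in>J. u j \<in> V j) \<and> norm ((\<Sum>j\<in>J. u j) - v) \<le> e n
    \<and> (\<Sum>j\<in>J. p j (u j)) \<le> a + e n}" for n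
  have dec: "decseq C"
  proof (rule decseq_SucI)
    fix n
    have "e (Suc n) \<le> e n" by (simp add: e_def field_simps)
    then show "C (Suc n) \<subseteq> C n" by (auto simp: C_def)
  qed
  have ne: "C n \<noteq> {}" for n
    using assms[OF e(2)[of n]] by (auto simp: C_def decompositions_def)
  have mid: "(\<lambda>j. (1/2) *\<^sub>R (x j + y j)) \<in> C n" if x: "x \<in> C n" and y: "y \<in> C n" for n x y
  proof -
    have "(\<Sum>j\<in>J. (1/2) *\<^sub>R (x j + y j)) - v
        = (1/2) *\<^sub>R (((\<Sum>j\<in>J. x j) - v) + ((\<Sum>j\<in>J. y j) - v))"
      by (simp add: scaleR_right.sum[symmetric] sum.distrib algebra_simps)
        (simp add: scaleR_add_left[symmetric])
    moreover have "norm (((\<Sum>j\<in>J. x j) - v) + ((\<Sum>j\<in>J. y j) - v)) \<le> e n + e n"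
      using x y by (intro norm_triangle_mono) (auto simp: C_def)
    ultimately have "norm ((\<Sum>j\<in>J. (1/2) *\<^sub>R (x j + y j)) - v) \<le> e n" by simp
    moreover have "(\<Sum>j\<in>J. p j ((1/2) *\<^sub>R (x j + y j))) \<le> (\<Sum>j\<in>J. (1/2) * (p j (x j) + p j (y j)))"
    proof (rule sum_mono)
      fix j
      assume j: "j \<in> J"
      then have xy: "x j \<in> V j" "y j \<in> V j" using x y by (auto simp: C_def)
      then show "p j ((1/2) *\<^sub>R (x j + y j)) \<le> (1/2) * (p j (x j) + p j (y j))"
        using norm_on_scaleR[OF norm_on_p[OF j] subspace_add[OF subspace_V[OF j] xy], of "1/2"]
          norm_on_triangle[OF norm_on_p[OF j] xy] by simp
    qed
    moreover have "(\<Sum>j\<in>J. (1/2) * (p j (x j) + p j (y j))) \<le> a + e n"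
      using x y by (simp add: C_def sum_distrib_left[symmetric] sum_divide_distrib[symmetric] sum.distrib)
    ultimately show ?thesis
      using x y subspace_V by (auto simp: C_def subspace_add subspace_scale)
  qed
  \<comment> \<open>Each local norm is at most the total cost, hence at most \<open>a + e 0\<close>;
    the constant \<open>c\<close> converts this to the Hilbertian norm.\<close>
  have bound: "(\<Sum>j\<in>J. (norm (x j))\<^sup>2) \<le> (\<Sum>j\<in>J. (c * (a + e 0))\<^sup>2)" if x: "x \<in> C 0" for x
  proof (rule sum_mono)
    fix j
    assume j: "j \<in> J"
    have "p j (x j) \<le> (\<Sum>j\<in>J. p j (x j))"
      using j x finite_J by (intro member_le_sum) (auto simp: C_def norm_on_nonneg[OF norm_on_p])
    also have "\<dots> \<le> a + e 0" using x by (simp add: C_def)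
    finally have "c * p j (x j) \<le> c * (a + e 0)" using c by simp
    moreover have "norm (x j) \<le> c * p j (x j)"
      using c(2)[OF j] j x by (auto simp: C_def)
    ultimately show "(norm (x j))\<^sup>2 \<le> (c * (a + e 0))\<^sup>2"
      by (intro power_mono) auto
  qed
  obtain s u where s: "\<And>n. s n \<in> C n"
      and lim: "\<And>j. j \<in> J \<Longrightarrow> (\<lambda>n. s n j) \<longlonglongrightarrow> u j"
    by (rule nested_convex_selection[OF finite_J dec ne mid bound]) auto
  have u: "u j \<in> V j" if "j \<in> J" for j
    using s that by (intro closed_sequentially[OF closed_V[OF that] _ lim[OF that]]) (auto simp: C_def)
  have "norm ((\<Sum>j\<in>J. u j) - v) \<le> 0"
  proof (rule LIMSEQ_le)
    show "(\<lambda>n. norm ((\<Sum>j\<in>J. s n j) - v)) \<longlonglongrightarrow> norm ((\<Sum>j\<in>J. u j) - v)"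
      by (intro tendsto_intros lim)
  qed (use e s in \<open>auto simp: C_def\<close>)
  moreover have "(\<Sum>j\<in>J. p j (u j)) \<le> a + 0"
  proof (rule LIMSEQ_le)
    show "(\<lambda>n. \<Sum>j\<in>J. p j (s n j)) \<longlonglongrightarrow> (\<Sum>j\<in>J. p j (u j))"
      using s by (intro tendsto_sum tendsto_p lim u) (auto simp: C_def)
    show "(\<lambda>n. a + e n) \<longlonglongrightarrow> a + 0"
      by (intro tendsto_intros e)
  qed (use s in \<open>auto simp: C_def\<close>)
  ultimately show thesis
    using u by (intro that) (auto simp: decompositions_def)
qed

lemma inf_norm_attained:
  obtains u where "u \<in> decompositions v" "(\<Sum>j\<in>J. p j (u j)) = inf_norm v"
proof -
  obtain u where u: "u \<in> decompositions v" "(\<Sum>j\<in>J. p j (u j)) \<le> inf_norm v"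
  proof (rule decomposition_of_approximate)
    fix e :: real
    assume "0 < e"
    then have "\<exists>u\<in>decompositions v. (\<Sum>j\<in>J. p j (u j)) < inf_norm v + e"
      using cInf_lessD[of "(\<lambda>u. \<Sum>j\<in>J. p j (u j)) ` decompositions v" "inf_norm v + e"]
        decompositions_nonempty by (auto simp: inf_norm_def)
    with \<open>0 < e\<close> show "\<exists>x. norm (x - v) \<le> e \<and>
        (\<exists>u\<in>decompositions x. (\<Sum>j\<in>J. p j (u j)) \<le> inf_norm v + e)"
      by (intro exI[of _ v]) (auto intro: less_imp_le)
  qed
  with inf_norm_le[OF u(1)] show thesis by (intro that[OF u(1)]) simp
qed

lemma norm_le_inf_norm: obtains c where "0 < c" "\<And>v. norm v \<le> c * inf_norm v"
proof -
  obtain c where c: "0 < c" "\<And>j x. j \<in> J \<Longrightarrow> x \<in> V j \<Longrightarrow> norm x \<le> c * p j x"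
    by (rule norm_le_p) blast
  have "norm v \<le> c * inf_norm v" for v
  proof -
    obtain u where u: "u \<in> decompositions v" "(\<Sum>j\<in>J. p j (u j)) = inf_norm v"
      by (rule inf_norm_attained)
    then have "v = (\<Sum>j\<in>J. u j)" by (simp add: decompositions_def)
    then have "norm v \<le> (\<Sum>j\<in>J. norm (u j))" by (simp only: norm_sum)
    also have "\<dots> \<le> (\<Sum>j\<in>J. c * p j (u j))"
      using u c by (intro sum_mono) (auto simp: decompositions_def)
    finally show ?thesis by (simp only: u sum_distrib_left[symmetric])
  qed
  with c(1) show thesis by (rule that)
qed

text \<open>Optimal decompositions exist, so they can be scaled and added directly, without
  approximation. Definiteness comes from the comparison with the Hilbertian norm.\<close>

lemma norm_on_inf_norm: "norm_on UNIV inf_norm"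
proof -
  have nonneg: "0 \<le> inf_norm v" for v
    using inf_norm_attained sum_p_nonneg by metis
  have scale_le: "inf_norm (r *\<^sub>R v) \<le> \<bar>r\<bar> * inf_norm v" for r v
  proof -
    obtain u where u: "u \<in> decompositions v" "(\<Sum>j\<in>J. p j (u j)) = inf_norm v"
      by (rule inf_norm_attained)
    then have "(\<lambda>j. r *\<^sub>R u j) \<in> decompositions (r *\<^sub>R v)"
      using subspace_V by (auto simp: decompositions_def subspace_scale scaleR_right.sum)
    then have "inf_norm (r *\<^sub>R v) \<le> (\<Sum>j\<in>J. p j (r *\<^sub>R u j))"
      by (rule inf_norm_le)
    also have "\<dots> = (\<Sum>j\<in>J. \<bar>r\<bar> * p j (u j))"
      using u norm_on_scaleR[OF norm_on_p] by (intro sum.cong) (auto simp: decompositions_def)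
    finally show ?thesis by (simp only: u sum_distrib_left[symmetric])
  qed
  have scale: "inf_norm (r *\<^sub>R v) = \<bar>r\<bar> * inf_norm v" for r v
  proof (cases "r = 0")
    case True
    then show ?thesis using scale_le[of 0 v] nonneg[of 0] by simp
  next
    case False
    have "\<bar>r\<bar> * inf_norm v \<le> \<bar>r\<bar> * (\<bar>inverse r\<bar> * inf_norm (r *\<^sub>R v))"
      using scale_le[of "inverse r" "r *\<^sub>R v"] False by (intro mult_left_mono) auto
    also have "\<dots> = inf_norm (r *\<^sub>R v)"
      using False by (simp add: abs_inverse)
    finally show ?thesis using scale_le[of r v] by simp
  qed
  have triangle: "inf_norm (v + w) \<le> inf_norm v + inf_norm w" for v w
  proof -
    obtain x where x: "x \<in> decompositions v" "(\<Sum>j\<in>J. p j (x j)) = inf_norm v"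
      by (rule inf_norm_attained)
    obtain y where y: "y \<in> decompositions w" "(\<Sum>j\<in>J. p j (y j)) = inf_norm w"
      by (rule inf_norm_attained)
    have "(\<lambda>j. x j + y j) \<in> decompositions (v + w)"
      using x y subspace_V by (auto simp: decompositions_def subspace_add sum.distrib)
    then have "inf_norm (v + w) \<le> (\<Sum>j\<in>J. p j (x j + y j))"
      by (rule inf_norm_le)
    also have "\<dots> \<le> (\<Sum>j\<in>J. p j (x j) + p j (y j))"
      using x y norm_on_triangle[OF norm_on_p] by (intro sum_mono) (auto simp: decompositions_def)
    finally show ?thesis by (simp only: x y sum.distrib)
  qed
  obtain c where "\<And>v. norm v \<le> c * inf_norm v"
    by (rule norm_le_inf_norm) blast
  then have "v = 0" if "inf_norm v = 0" for v
    using that by (metis mult_zero_right norm_le_zero_iff)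
  with nonneg scale triangle scale[of 0 0] show ?thesis
    unfolding norm_on_def by auto
qed

section \<open>The unit ball of the convolution\<close>

lemma bounded_unit_ball_inf_norm: "bounded (unit_ball_on UNIV inf_norm)"
proof -
  obtain c where "\<And>v. norm v \<le> c * inf_norm v"
    by (rule norm_le_inf_norm) blast
  then show ?thesis
    using norm_le_of_unit_ball_on[OF norm_on_inf_norm] unfolding bounded_iff by metis
qed

lemma convex_unit_ball_inf_norm: "convex (unit_ball_on UNIV inf_norm)"
proof (rule convexI)
  fix x y and s t :: real
  assume xy: "x \<in> unit_ball_on UNIV inf_norm" "y \<in> unit_ball_on UNIV inf_norm"
    and st: "0 \<le> s" "0 \<le> t" "s + t = 1"
  have "inf_norm (s *\<^sub>R x + t *\<^sub>R y) \<le> s * inf_norm x + t * inf_norm y"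
    using norm_on_triangle[OF norm_on_inf_norm, of "s *\<^sub>R x" "t *\<^sub>R y"] st
    by (simp add: norm_on_scaleR[OF norm_on_inf_norm])
  also have "\<dots> \<le> 1"
    using convex_bound_le[of "inf_norm x" 1 "inf_norm y" s t] xy st by (simp add: unit_ball_on_def)
  finally show "s *\<^sub>R x + t *\<^sub>R y \<in> unit_ball_on UNIV inf_norm"
    by (simp add: unit_ball_on_def)
qed

lemma closed_unit_ball_inf_norm: "closed (unit_ball_on UNIV inf_norm)"
proof -
  have "v \<in> unit_ball_on UNIV inf_norm" if v: "v \<in> closure (unit_ball_on UNIV inf_norm)" for v
  proof -
    obtain u where u: "u \<in> decompositions v" "(\<Sum>j\<in>J. p j (u j)) \<le> 1"
    proof (rule decomposition_of_approximate)
      fix e :: real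
      assume "0 < e"
      then obtain x where x: "inf_norm x \<le> 1" "dist x v < e"
        using v by (auto simp: closure_approachable unit_ball_on_def)
      obtain u where "u \<in> decompositions x" "(\<Sum>j\<in>J. p j (u j)) = inf_norm x"
        by (rule inf_norm_attained)
      with x \<open>0 < e\<close> show "\<exists>x. norm (x - v) \<le> e \<and>
          (\<exists>u\<in>decompositions x. (\<Sum>j\<in>J. p j (u j)) \<le> 1 + e)"
        by (intro exI[of _ x] conjI bexI[of _ u]) (auto simp: dist_norm)
    qed
    with inf_norm_le[OF u(1)] show ?thesis by (simp add: unit_ball_on_def)
  qed
  then show ?thesis
    unfolding closure_subset_eq[symmetric] by (rule subsetI)
qed

lemma inf_norm_le_p:
  assumes "j \<in> J" "x \<in> V j"
  shows "inf_norm x \<le> p j x"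
proof -
  \<comment> \<open>The competitor puts all of \<open>x\<close> into the component
    \<open>j\<close>.\<close>
  have "(\<lambda>i. if i = j then x else 0) \<in> decompositions x"
    using assms finite_J subspace_V by (auto simp: decompositions_def subspace_0)
  from inf_norm_le[OF this] have "inf_norm x \<le> (\<Sum>i\<in>J. p i (if i = j then x else 0))" .
  also have "\<dots> = (\<Sum>i\<in>J. if i = j then p j x else 0)"
    by (intro sum.cong) (auto simp: p_0)
  finally show ?thesis using assms finite_J by simp
qed

lemma unit_ball_p_subset: "j \<in> J \<Longrightarrow> unit_ball_on (V j) (p j) \<subseteq> unit_ball_on UNIV inf_norm"
  using inf_norm_le_p by (force simp: unit_ball_on_def)

text \<open>The ball is closed, convex and contains each local ball, which gives one inclusion.
  Conversely, an optimal decomposition writes \<open>v\<close> as a convex combination of points of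
  the local balls and 0, so \<open>v\<close> lies in the hull even before closure.\<close>

lemma unit_ball_inf_norm:
  "unit_ball_on UNIV inf_norm = closed_convex_hull (\<Union>j\<in>J. unit_ball_on (V j) (p j))"
proof
  let ?X = "\<Union>j\<in>J. unit_ball_on (V j) (p j)"
  show "closed_convex_hull ?X \<subseteq> unit_ball_on UNIV inf_norm"
    unfolding closed_convex_hull_def using unit_ball_p_subset
    by (intro closure_minimal hull_minimal closed_unit_ball_inf_norm) (auto simp: convex_unit_ball_inf_norm)
  have "v \<in> convex hull ?X" if "inf_norm v \<le> 1" for v
  proof -
    obtain u where u: "u \<in> decompositions v" "(\<Sum>j\<in>J. p j (u j)) = inf_norm v"
      by (rule inf_norm_attained)
    then have uV: "u j \<in> V j" if "j \<in> J" for j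
      using that by (auto simp: decompositions_def)
    have zero: "0 \<in> convex hull ?X"
    proof -
      obtain j where "j \<in> J" using J_nonempty by blast
      then show ?thesis using zero_in_unit_ball_p by (auto intro: hull_inc)
    qed
    \<comment> \<open>If \<open>p j (u j)\<close> is 0, then \<open>inverse 0 = 0\<close> makes
      \<open>y j\<close> zero, which still lies in the local ball.\<close>
    define y where "y j = inverse (p j (u j)) *\<^sub>R u j" for j
    have y: "y j \<in> convex hull ?X" if "j \<in> J" for j
    proof -
      have "y j \<in> V j" "p j (y j) \<le> 1"
        using that uV subspace_V norm_on_scaleR[OF norm_on_p] norm_on_nonneg[OF norm_on_p]
        by (auto simp: y_def subspace_scale) (metis left_inverse order_refl zero_le_one mult_zero_right)
      with that show ?thesis by (auto simp: unit_ball_on_def intro: hull_inc)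
    qed
    have "v = (\<Sum>j\<in>J. u j)" using u by (simp add: decompositions_def)
    also have "\<dots> = (\<Sum>j\<in>J. p j (u j) *\<^sub>R y j)"
    proof (rule sum.cong)
      fix j
      assume "j \<in> J"
      then have "p j (u j) = 0 \<longleftrightarrow> u j = 0"
        by (intro norm_on_eq_0[OF norm_on_p] uV)
      then show "u j = p j (u j) *\<^sub>R y j" by (auto simp: y_def)
    qed simp
    also have "\<dots> = (1 - inf_norm v) *\<^sub>R 0 + (\<Sum>j\<in>J. p j (u j) *\<^sub>R y j)" by simp
    also have "\<dots> \<in> convex hull ?X"
    proof -
      \<comment> \<open>The index \<open>None\<close> carries the leftover weight
        \<open>1 - inf_norm v\<close>, placed at 0, so that the weights sum to 1.\<close>
      define f where "f i = (case i of None \<Rightarrow> 0 | Some j \<Rightarrow> y j)" for i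
      define a where "a i = (case i of None \<Rightarrow> 1 - inf_norm v | Some j \<Rightarrow> p j (u j))" for i
      have split: "(\<Sum>i\<in>insert None (Some ` J). g i) = g None + (\<Sum>j\<in>J. g (Some j))"
        for g :: "'j option \<Rightarrow> 'b::comm_monoid_add"
        using finite_J by (simp add: sum.insert sum.reindex)
      have "(\<Sum>i\<in>insert None (Some ` J). a i *\<^sub>R f i) \<in> convex hull ?X"
      proof (rule convex_sum)
        show "(\<Sum>i\<in>insert None (Some ` J). a i) = 1"
          unfolding split by (simp add: a_def u)
        show "\<And>i. i \<in> insert None (Some ` J) \<Longrightarrow> 0 \<le> a i"
          using that uV norm_on_nonneg[OF norm_on_p] by (auto simp: a_def)
        show "\<And>i. i \<in> insert None (Some ` J) \<Longrightarrow> f i \<in> convex hull ?X"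
          using y zero by (auto simp: f_def)
      qed (use finite_J convex_convex_hull in auto)
      then show ?thesis unfolding split by (simp add: a_def f_def)
    qed
    finally show ?thesis .
  qed
  then show "unit_ball_on UNIV inf_norm \<subseteq> closed_convex_hull ?X"
    unfolding closed_convex_hull_def unit_ball_on_def using closure_subset by blast
qed

section \<open>The dual norm of the convolution\<close>

lemma norm_on_dual_p: "j \<in> J \<Longrightarrow> norm_on (V j) (dual_norm_on (V j) (p j))"
  using norm_le_p norm_on_dual_norm_on[OF subspace_V norm_on_p] by metis

lemma norm_on_dual_inf_norm: "norm_on UNIV (dual_norm_on UNIV inf_norm)"
  using norm_le_inf_norm norm_on_dual_norm_on[OF subspace_UNIV norm_on_inf_norm] by metis

text \<open>The \<open>j\<close>-th term is the supremum of the pairing with \<open>y\<close> over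
  the \<open>j\<close>-th local ball, a subset of the global ball. Conversely, pairing an optimal
  decomposition with \<open>y\<close> term by term gives at most its total cost times the largest
  term.\<close>

lemma dual_inf_norm:
  "dual_norm_on UNIV inf_norm y
    = (SUP j\<in>J. dual_norm_on (V j) (p j) (orthogonal_projection (V j) y))"
proof -
  define D where "D j = dual_norm_on (V j) (p j) (orthogonal_projection (V j) y)" for j
  obtain c where c: "0 < c" "\<And>j x. j \<in> J \<Longrightarrow> x \<in> V j \<Longrightarrow> norm x \<le> c * p j x"
    by (rule norm_le_p) blast
  obtain c' where c': "\<And>v. norm v \<le> c' * inf_norm v"
    by (rule norm_le_inf_norm) blast
  have inner_proj: "x \<bullet> orthogonal_projection (V j) y = x \<bullet> y" if "j \<in> J" "x \<in> V j" for j x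
    using that by (intro inner_orthogonal_projection closed_V subspace_V)
  have "D j \<le> dual_norm_on UNIV inf_norm y" if j: "j \<in> J" for j
    unfolding D_def dual_norm_on_def[of "V j"]
  proof (rule cSUP_least)
    show "unit_ball_on (V j) (p j) \<noteq> {}" using zero_in_unit_ball_p[OF j] by blast
    fix x
    assume x: "x \<in> unit_ball_on (V j) (p j)"
    then have "x \<bullet> orthogonal_projection (V j) y = x \<bullet> y"
      by (intro inner_proj[OF j]) (simp add: unit_ball_on_def)
    also have "\<dots> \<le> dual_norm_on UNIV inf_norm y"
      unfolding dual_norm_on_def using unit_ball_p_subset[OF j] x
      by (intro cSUP_upper bdd_above_inner_unit_ball_on[OF norm_on_inf_norm c']) auto
    finally show "x \<bullet> orthogonal_projection (V j) y \<le> dual_norm_on UNIV inf_norm y" .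
  qed
  then have ge: "(SUP j\<in>J. D j) \<le> dual_norm_on UNIV inf_norm y"
    using J_nonempty by (intro cSUP_least) auto
  have D_le: "D j \<le> (SUP j\<in>J. D j)" if "j \<in> J" for j
    using that finite_J by (intro cSUP_upper) auto
  have D_nonneg: "0 \<le> D j" if "j \<in> J" for j
    unfolding D_def using that
    by (intro norm_on_nonneg[OF norm_on_dual_p] orthogonal_projection_in closed_V subspace_V)
  have "dual_norm_on UNIV inf_norm y \<le> (SUP j\<in>J. D j)"
    unfolding dual_norm_on_def[of UNIV]
  proof (rule cSUP_least)
    obtain j where "j \<in> J" using J_nonempty by blast
    with zero_in_unit_ball_p unit_ball_p_subset show "unit_ball_on UNIV inf_norm \<noteq> {}" by blast
    \<comment> \<open>Nonnegativity permits replacing the factor \<open>inf_norm v \<le> 1\<close>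
      by 1 at the end.\<close>
    have SUP_nonneg: "0 \<le> (SUP j\<in>J. D j)"
      using D_le D_nonneg \<open>j \<in> J\<close> by (meson order_trans)
    fix v
    assume "v \<in> unit_ball_on UNIV inf_norm"
    then have v: "inf_norm v \<le> 1" by (simp add: unit_ball_on_def)
    obtain u where u: "u \<in> decompositions v" "(\<Sum>j\<in>J. p j (u j)) = inf_norm v"
      by (rule inf_norm_attained)
    have "v \<bullet> y = (\<Sum>j\<in>J. u j \<bullet> y)"
      using u(1) by (auto simp: decompositions_def inner_sum_left)
    also have "\<dots> \<le> (\<Sum>j\<in>J. p j (u j) * (SUP j\<in>J. D j))"
    proof (rule sum_mono)
      fix j
      assume j: "j \<in> J"
      with u have uj: "u j \<in> V j" by (simp add: decompositions_def)
      have "u j \<bullet> y = u j \<bullet> orthogonal_projection (V j) y"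
        by (rule inner_proj[OF j uj, symmetric])
      also have "\<dots> \<le> p j (u j) * D j"
        unfolding D_def
        by (rule inner_le_norm_mult_dual_norm_on[OF subspace_V[OF j] norm_on_p[OF j] c(2)[OF j] uj])
      also have "\<dots> \<le> p j (u j) * (SUP j\<in>J. D j)"
        using D_le[OF j] norm_on_nonneg[OF norm_on_p[OF j] uj] by (rule mult_left_mono)
      finally show "u j \<bullet> y \<le> p j (u j) * (SUP j\<in>J. D j)" .
    qed
    also have "\<dots> = inf_norm v * (SUP j\<in>J. D j)"
      by (simp only: u sum_distrib_right[symmetric])
    also have "\<dots> \<le> (SUP j\<in>J. D j)"
      using mult_right_mono[OF v SUP_nonneg] by simp
    finally show "v \<bullet> y \<le> (SUP j\<in>J. D j)" .
  qed
  from this ge show ?thesis unfolding D_def by (rule antisym)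
qed

end

section \<open>The lower bound and the dual formulas\<close>

theorem theorem16:
  fixes J :: "'j set"
    and W :: "'j \<Rightarrow> 'a::{real_inner, complete_space} set"
    and p :: "'j \<Rightarrow> 'a \<Rightarrow> real"
    and \<theta> :: "'j \<Rightarrow> 'a \<Rightarrow> 'a"
    and h :: "'a \<Rightarrow> ereal"
  assumes J: "finite J" "J \<noteq> {}"
    and W_disjoint: "disjoint_family_on W J"
    and W_symmetric: "\<And>j. j \<in> J \<Longrightarrow> symmetric_set (W j)"
    and span_sum: "(\<Sum>j\<in>J. closed_span (W j)) = (UNIV :: 'a set)"
    and local_norm: "\<And>j. j \<in> J \<Longrightarrow> norm_on (closed_span (W j)) (p j)"
    and local_equivalent: "\<And>j. j \<in> J \<Longrightarrow> equivalent_norms_on (closed_span (W j)) (p j) norm"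
    and \<theta>_symmetric: "\<And>j. j \<in> J \<Longrightarrow> symmetric_map_on (W j) (\<theta> j)"
    and sphere_subset: "\<And>j. j \<in> J \<Longrightarrow>
          unit_sphere_on (closed_span (W j)) (p j) \<subseteq> closure (\<theta> j ` W j)"
    and subset_ball: "\<And>j. j \<in> J \<Longrightarrow>
          closure (\<theta> j ` W j) \<subseteq> unit_ball_on (closed_span (W j)) (p j)"
    and conj_proper: "\<And>j. j \<in> J \<Longrightarrow>
          proper_fun (fenchel_conjugate (infimal_postcomp (W j) (\<theta> j) h))"
    and common_dom: "(\<Inter>j\<in>J. effective_dom
          (fenchel_conjugate (infimal_postcomp (W j) (\<theta> j) h))) \<noteq> {}"
  shows "\<exists>N :: 'a \<Rightarrow> real.
      norm_on UNIV N \<and>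
      unit_ball_on UNIV N = closed_convex_hull (\<Union>j\<in>J. unit_ball_on (closed_span (W j)) (p j)) \<and>
      (\<exists>m. has_min_on
             (fenchel_conjugate
               (\<lambda>y. SUP j\<in>J. fenchel_conjugate (infimal_postcomp (W j) (\<theta> j) h) y))
             (unit_ball_on UNIV N) m \<and>
           m \<le> (INF w\<in>(\<Union>j\<in>J. W j). h w)) \<and>
      (\<forall>v. N v = Inf {\<Sum>j\<in>J. p j (u j) | u.
                       (\<forall>j\<in>J. u j \<in> closed_span (W j)) \<and> (\<Sum>j\<in>J. u j) = v}) \<and>
      norm_on UNIV (dual_norm_on UNIV N) \<and>
      (\<forall>j\<in>J. norm_on (closed_span (W j)) (dual_norm_on (closed_span (W j)) (p j))) \<and>
      (\<forall>y. dual_norm_on UNIV N y =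
             (SUP j\<in>J. dual_norm_on (closed_span (W j)) (p j)
                          (orthogonal_projection (closed_span (W j)) y)))"
proof -
  interpret local_norms J "\<lambda>j. closed_span (W j)" p
    using J span_sum local_norm local_equivalent
    by unfold_locales (auto simp: subspace_closed_span, auto simp: closed_span_def)
  let ?f = "\<lambda>j. infimal_postcomp (W j) (\<theta> j) h"
  let ?F = "\<lambda>y. SUP j\<in>J. fenchel_conjugate (?f j) y"
  let ?K = "unit_ball_on UNIV inf_norm"
  define m where "m = (INF v\<in>?K. fenchel_conjugate ?F v)"
  have "?K \<noteq> {}"
    using J_nonempty zero_in_unit_ball_p unit_ball_p_subset by blast
  then have min: "has_min_on (fenchel_conjugate ?F) ?K m"
    unfolding m_def
    by (intro fenchel_conjugate_attains_min closed_unit_ball_inf_norm convex_unit_ball_inf_norm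
        bounded_unit_ball_inf_norm)
  have lower: "m \<le> h w" if j: "j \<in> J" and w: "w \<in> W j" for j w
  proof -
    \<comment> \<open>The image lies in the local ball, hence in the global one, so it competes in
      the minimum.\<close>
    have "\<theta> j w \<in> ?K"
      using subset_ball[OF j] closure_subset w unit_ball_p_subset[OF j] by blast
    then have "m \<le> fenchel_conjugate ?F (\<theta> j w)"
      unfolding m_def by (rule INF_lower)
    \<comment> \<open>\<open>?F\<close> dominates its \<open>j\<close>-th term, and conjugation
      reverses this.\<close>
    also have "\<dots> \<le> fenchel_conjugate (fenchel_conjugate (?f j)) (\<theta> j w)"
      using j by (intro fenchel_conjugate_antimono SUP_upper)
    also have "\<dots> \<le> ?f j (\<theta> j w)"
      by (rule fenchel_biconjugate_le)
    \<comment> \<open>The point \<open>w\<close> itself lies in the fibre of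
      \<open>\<theta> j\<close> over \<open>\<theta> j w\<close>.\<close>
    also have "\<dots> \<le> h w"
      unfolding infimal_postcomp_def using w by (intro INF_lower) simp
    finally show ?thesis .
  qed
  have formula: "inf_norm v = Inf {\<Sum>j\<in>J. p j (u j) | u.
      (\<forall>j\<in>J. u j \<in> closed_span (W j)) \<and> (\<Sum>j\<in>J. u j) = v}" for v
    unfolding inf_norm_def decompositions_def by (simp add: image_Collect)
  show ?thesis
  proof (intro exI[of _ inf_norm] conjI allI ballI)
    show "\<exists>m. has_min_on (fenchel_conjugate ?F) ?K m \<and> m \<le> (INF w\<in>(\<Union>j\<in>J. W j). h w)"
      using min lower by (intro exI[of _ m]) (auto intro: INF_greatest)
  qed (fact norm_on_inf_norm unit_ball_inf_norm formula norm_on_dual_inf_norm dual_inf_norm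
      | simp add: norm_on_dual_p)+
qed

end
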